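(* Let $d \geq 3$ be an integer and let $G$ be a finite simple graph with maximum degree $d$. If $G$ does not contain $K_{d+1}$ as a subgraph, then $G$ has a $d$-coloring in which one color class has size $\alpha(G)$. In particular, $\chi(G) \leq d$.
   Context: A $d$-coloring of $G$ is a partition of $V(G)$ into $d$ independent sets (the color classes). $\alpha(G)$ denotes the independence number of $G$ (the maximum size of an independent set), and $\chi(G)$ denotes the chromatic number of $G$. $K_{d+1}$ is the complete graph on $d+1$ vertices. *)

theory Defs
  imports "Graph_Theory.Graph_Theory" "HOL-Library.Disjoint_Sets"
begin

text \<open>
  A finite simple graph is rendered by the locale predicate \<^const>\<open>graph\<close>: a finite loop-free
  digraph without parallel arcs whose adjacency relation is symmetric. An undirected edge
  \<open>{u, v}\<close> is the pair of arcs from \<open>u\<close> to \<open>v\<close> and from \<open>v\<close> to \<open>u\<close>, so the degree of a vertex is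
  its out-degree. Likewise, \<^const>\<open>complete_digraph\<close> with parameter \<open>n\<close> characterises \<open>K\<^sub>n\<close>.
\<close>

text \<open>The inserted 0 only matters for the graph without vertices.\<close>

definition max_degree :: "('a, 'b) pre_digraph \<Rightarrow> nat" where
  "max_degree G = Max (insert 0 (out_degree G ` verts G))"

definition independent_set :: "('a, 'b) pre_digraph \<Rightarrow> 'a set \<Rightarrow> bool" where
  "independent_set G S \<longleftrightarrow> S \<subseteq> verts G \<and> (\<forall>u\<in>S. \<forall>v\<in>S. \<not> u \<rightarrow>\<^bsub>G\<^esub> v)"

definition independence_number :: "('a, 'b) pre_digraph \<Rightarrow> nat" where
  "independence_number G = Max (card ` {S. independent_set G S})"

text \<open>
  The colour classes are \<open>C 0, \<dots>, C (d - 1)\<close>; as usual for colourings with \<open>d\<close> colours, some of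
  them may be empty. The values \<open>C i\<close> for \<open>i \<ge> d\<close> are irrelevant.
\<close>

definition coloring :: "('a, 'b) pre_digraph \<Rightarrow> nat \<Rightarrow> (nat \<Rightarrow> 'a set) \<Rightarrow> bool" where
  "coloring G d C \<longleftrightarrow>
     (\<Union>i<d. C i) = verts G \<and> disjoint_family_on C {..<d} \<and> (\<forall>i<d. independent_set G (C i))"

definition chromatic_number :: "('a, 'b) pre_digraph \<Rightarrow> nat" where
  "chromatic_number G = (LEAST k. \<exists>C. coloring G k C)"

text \<open>The maximum and the minimum above are attained for every finite simple graph.\<close>

lemma independence_number_attained:
  assumes "graph G"
  shows "\<exists>S. independent_set G S \<and> card S = independence_number G"
proof -
  interpret graph G by fact
  have "finite {S. independent_set G S}"
    by (rule finite_subset[of _ "Pow (verts G)"]) (auto simp: independent_set_def)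
  moreover have "independent_set G {}"
    by (simp add: independent_set_def)
  ultimately have "independence_number G \<in> card ` {S. independent_set G S}"
    unfolding independence_number_def by (intro Max_in) auto
  then show ?thesis by auto
qed

lemma chromatic_number_attained:
  assumes "graph G"
  shows "\<exists>C. coloring G (chromatic_number G) C"
proof -
  interpret graph G by fact
  obtain h and n :: nat where h: "bij_betw h {0..<n} (verts G)"
    using ex_bij_betw_nat_finite[OF finite_verts] by blast
  have img: "h ` {..<n} = verts G" and inj: "inj_on h {..<n}"
    using h by (simp_all add: bij_betw_def atLeast0LessThan)
  have "coloring G n (\<lambda>i. {h i})"
    unfolding coloring_def
  proof (intro conjI allI impI)
    show "(\<Union>i<n. {h i}) = verts G"
      unfolding img[symmetric] by blast
    show "disjoint_family_on (\<lambda>i. {h i}) {..<n}"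
      using inj unfolding disjoint_family_on_def inj_on_def by blast
    show "independent_set G {h i}" if "i < n" for i
    proof -
      have "h i \<in> verts G" using img that by blast
      moreover have "\<not> h i \<rightarrow>\<^bsub>G\<^esub> h i" by (rule notI) (erule adj_not_same)
      ultimately show ?thesis by (simp add: independent_set_def)
    qed
  qed
  then show ?thesis
    unfolding chromatic_number_def by (rule LeastI[where P = "\<lambda>k. \<exists>C. coloring G k C", OF exI])
qed

end

theory Submission
  imports Defs "HOL-Combinatorics.Transposition"
begin

text \<open>
  Choose a maximum independent set \<open>S\<close> for which the number of \<open>d\<close>-vertex-critical subsets of
  \<open>V - S\<close> is minimal, and suppose that \<open>K\<close> is one of them. Every vertex outside \<open>S\<close> has a
  neighbour in \<open>S\<close>, so \<open>K\<close> is \<open>(d - 1)\<close>-regular, is a connected component of \<open>V - S\<close> without a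
  cut vertex, and each of its vertices has exactly one neighbour in \<open>S\<close>. Exchanging \<open>v\<in>K\<close> with
  its neighbour \<open>s\<in>S\<close> destroys \<open>K\<close>; by minimality a new critical set arises, and it contains \<open>s\<close>.
  If \<open>s\<close> had two neighbours in \<open>K\<close>, the new set would be \<open>K - {v} \<union> {s}\<close>, which makes \<open>K\<close> together
  with \<open>s\<close> a clique on \<open>d + 1\<close> vertices. Otherwise the exchange can be repeated, always at a
  neighbour of the vertex last brought in; what remains of the earlier critical sets is never
  entered again, because the entering vertex has at most one neighbour there. So the
  exchanges go on forever in a finite graph, a contradiction.
\<close>

section \<open>Colourability and vertex-critical sets\<close>

locale neighbourhood_graph =
  fixes V :: "'a set" and N :: "'a \<Rightarrow> 'a set"
  assumes finite_V: "finite V"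
    and N_subset: "N x \<subseteq> V"
    and N_irrefl: "x \<notin> N x"
    and N_sym: "y \<in> N x \<Longrightarrow> x \<in> N y"
begin

lemma finite_N: "finite (N x)"
  using finite_V N_subset finite_subset by blast

definition colorable :: "nat \<Rightarrow> 'a set \<Rightarrow> bool" where
  "colorable k A \<longleftrightarrow>
     (\<exists>f::'a \<Rightarrow> nat. f ` A \<subseteq> {..<k} \<and> (\<forall>x\<in>A. \<forall>y\<in>A. y \<in> N x \<longrightarrow> f x \<noteq> f y))"

text \<open>This is (k+1)-vertex-critical in the usual terminology, so the d-critical sets of the
  idea above are those with parameter \<open>d - 1\<close>.\<close>

definition critical :: "nat \<Rightarrow> 'a set \<Rightarrow> bool" where
  "critical k K \<longleftrightarrow> K \<subseteq> V \<and> \<not> colorable k K \<and> (\<forall>x\<in>K. colorable k (K - {x}))"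

lemma colorable_mono: "colorable k B \<Longrightarrow> A \<subseteq> B \<Longrightarrow> colorable k A"
  unfolding colorable_def by (meson image_mono order_trans subsetD)

lemma colorable_empty: "colorable k {}"
  by (simp add: colorable_def)

lemma critical_psubset:
  assumes "critical k K" "A \<subset> K"
  shows "colorable k A"
proof -
  obtain x where "x \<in> K" "A \<subseteq> K - {x}" using assms(2) by blast
  then show ?thesis using assms(1) colorable_mono unfolding critical_def by blast
qed

lemma ex_critical_subset:
  assumes "A \<subseteq> V" "\<not> colorable k A"
  shows "\<exists>K\<subseteq>A. critical k K"
proof -
  have "finite A" using assms(1) finite_V finite_subset by blast
  then have "finite {K. K \<subseteq> A \<and> \<not> colorable k K}" by simp
  moreover have "{K. K \<subseteq> A \<and> \<not> colorable k K} \<noteq> {}" using assms(2) by blast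
  ultimately have "\<exists>K\<in>{K. K \<subseteq> A \<and> \<not> colorable k K}. \<forall>L\<in>{K. K \<subseteq> A \<and> \<not> colorable k K}. L \<subseteq> K \<longrightarrow> K = L"
    by (rule finite_has_minimal)
  then obtain K where K: "K \<subseteq> A" "\<not> colorable k K"
    and min: "\<forall>L\<in>{K. K \<subseteq> A \<and> \<not> colorable k K}. L \<subseteq> K \<longrightarrow> K = L"
    by blast
  have "colorable k (K - {x})" if "x \<in> K" for x
  proof (rule ccontr)
    assume "\<not> colorable k (K - {x})"
    then have "K = K - {x}" using min K(1) by (metis (mono_tags) Diff_subset mem_Collect_eq order_trans)
    then show False using that by blast
  qed
  then show ?thesis using K assms(1) unfolding critical_def by blast
qed

text \<open>With fewer than \<open>k\<close> neighbours in \<open>K\<close>, some colour would be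
  missing around \<open>x\<close>, and a colouring of \<open>K - {x}\<close> would extend to
  \<open>K\<close>.\<close>

lemma critical_degree:
  assumes "critical k K" "x \<in> K"
  shows "k \<le> card (N x \<inter> K)"
proof (rule ccontr)
  assume less: "\<not> k \<le> card (N x \<inter> K)"
  obtain f :: "'a \<Rightarrow> nat" where f: "f ` (K - {x}) \<subseteq> {..<k}"
    "\<forall>u\<in>K - {x}. \<forall>v\<in>K - {x}. v \<in> N u \<longrightarrow> f u \<noteq> f v"
    using assms unfolding critical_def colorable_def by blast
  have "card (f ` (N x \<inter> K)) < card {..<k}"
    using less card_image_le[of "N x \<inter> K" f] finite_N[of x] by simp
  then have "\<not> {..<k} \<subseteq> f ` (N x \<inter> K)"
    using card_mono[of "f ` (N x \<inter> K)" "{..<k}"] finite_N[of x] by auto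
  then obtain c where c: "c < k" "c \<notin> f ` (N x \<inter> K)" by auto
  have "colorable k K"
    unfolding colorable_def
  proof (intro exI[of _ "f(x := c)"] conjI ballI impI)
    show "(f(x := c)) ` K \<subseteq> {..<k}" using f(1) c(1) by auto
    show "(f(x := c)) u \<noteq> (f(x := c)) v" if "u \<in> K" "v \<in> K" "v \<in> N u" for u v
      using f(2) c(2) that N_irrefl[of u] N_sym[of v u] by (auto simp: image_iff)
  qed
  then show False using assms(1) unfolding critical_def by blast
qed

section \<open>Gluing of colourings and connectivity of critical sets\<close>

text \<open>The colourings of the two sides are matched on the cut vertex by permuting colours.\<close>

lemma colorable_glue:
  assumes "colorable k (A \<union> Z)" "colorable k (B \<union> Z)" "Z \<subseteq> {z}"
    and sep: "\<And>a b. a \<in> A \<Longrightarrow> b \<in> B \<Longrightarrow> b \<notin> N a"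
    and disj: "A \<inter> B = {}" "Z \<inter> B = {}"
  shows "colorable k (A \<union> B \<union> Z)"
proof -
  obtain f :: "'a \<Rightarrow> nat" where f: "f ` (A \<union> Z) \<subseteq> {..<k}"
    "\<forall>u\<in>A \<union> Z. \<forall>v\<in>A \<union> Z. v \<in> N u \<longrightarrow> f u \<noteq> f v"
    using assms(1) unfolding colorable_def by blast
  obtain g :: "'a \<Rightarrow> nat" where g: "g ` (B \<union> Z) \<subseteq> {..<k}"
    "\<forall>u\<in>B \<union> Z. \<forall>v\<in>B \<union> Z. v \<in> N u \<longrightarrow> g u \<noteq> g v"
    using assms(2) unfolding colorable_def by blast
  obtain p :: "nat \<Rightarrow> nat" where p: "inj p" "p ` {..<k} \<subseteq> {..<k}" "\<And>x. x \<in> Z \<Longrightarrow> p (g x) = f x"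
  proof (cases "Z = {}")
    case True
    then show ?thesis using that[of id] by simp
  next
    case False
    then have "Z = {z}" using assms(3) by blast
    then have "f z < k" "g z < k" using f(1) g(1) by auto
    then have "transpose (g z) (f z) ` {..<k} \<subseteq> {..<k}" by (auto simp: transpose_def)
    moreover have "transpose (g z) (f z) (g x) = f x" if "x \<in> Z" for x
      using that \<open>Z = {z}\<close> by simp
    ultimately show ?thesis by (rule that[OF inj_transpose])
  qed
  define h where "h x = (if x \<in> B then p (g x) else f x)" for x
  have hB: "h x = p (g x)" if "x \<in> B \<union> Z" for x
    using that p(3) disj by (auto simp: h_def)
  have hA: "h x = f x" if "x \<in> A \<union> Z" for x
    using that disj by (auto simp: h_def)
  show ?thesis
    unfolding colorable_def
  proof (intro exI[of _ h] conjI ballI impI)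
    show "h ` (A \<union> B \<union> Z) \<subseteq> {..<k}"
    proof (rule image_subsetI)
      fix x assume "x \<in> A \<union> B \<union> Z"
      then consider "x \<in> A \<union> Z" | "x \<in> B \<union> Z" by blast
      then show "h x \<in> {..<k}"
      proof cases
        case 1
        then show ?thesis using f(1) hA[of x] by auto
      next
        case 2
        then have "g x \<in> {..<k}" using g(1) by blast
        then have "p (g x) \<in> {..<k}" using p(2) by blast
        then show ?thesis using hB[OF 2] by simp
      qed
    qed
    show "h u \<noteq> h v" if uv: "u \<in> A \<union> B \<union> Z" "v \<in> A \<union> B \<union> Z" "v \<in> N u" for u v
    proof -
      have "\<not> (u \<in> A \<and> v \<in> B)" "\<not> (u \<in> B \<and> v \<in> A)"
        using sep[of u v] sep[of v u] uv(3) N_sym[of v u] by blast+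
      then consider "u \<in> A \<union> Z" "v \<in> A \<union> Z" | "u \<in> B \<union> Z" "v \<in> B \<union> Z"
        using uv by blast
      then show ?thesis
      proof cases
        case 1
        then have "f u \<noteq> f v" using f(2) uv(3) by blast
        then show ?thesis using hA 1 by simp
      next
        case 2
        then have "g u \<noteq> g v" using g(2) uv(3) by blast
        then show ?thesis using hB 2 p(1) by (simp add: inj_eq)
      qed
    qed
  qed
qed

text \<open>Otherwise \<open>A \<union> Z\<close> and \<open>(K - Z - A) \<union> Z\<close> are
  proper subsets of \<open>K\<close>, hence colourable, and their colourings glue to one of
  \<open>K\<close>. The case \<open>Z = {}\<close> is connectedness; \<open>Z = {z}\<close> is the
  absence of a cut vertex.\<close>

lemma critical_connected:
  assumes K: "critical k K" and Z: "Z \<subseteq> {z}" "Z \<subseteq> K"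
    and A: "A \<noteq> {}" "A \<subseteq> K - Z" and closed: "\<And>a. a \<in> A \<Longrightarrow> N a \<inter> K \<subseteq> A \<union> Z"
  shows "A = K - Z"
proof (rule ccontr)
  assume "A \<noteq> K - Z"
  define B where "B = K - Z - A"
  have "B \<noteq> {}" using \<open>A \<noteq> K - Z\<close> A by (auto simp: B_def)
  then have "A \<union> Z \<subset> K" "B \<union> Z \<subset> K" using A Z by (auto simp: B_def)
  then have "colorable k (A \<union> B \<union> Z)"
    using critical_psubset[OF K] closed Z by (intro colorable_glue[of k A Z B z]) (auto simp: B_def)
  moreover have "A \<union> B \<union> Z = K" using A Z by (auto simp: B_def)
  ultimately show False using K unfolding critical_def by simp
qed

lemmas critical_connected0 = critical_connected[where Z = "{}", simplified]

text \<open>Absence of a cut vertex, phrased for a set \<open>R\<close> that may reach outside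
  \<open>K\<close>.\<close>

lemma critical_minus_subset:
  assumes K: "critical k K" "s \<in> K"
    and R: "(K - {s}) \<inter> R \<noteq> {}" and closed: "\<And>r. r \<in> R \<Longrightarrow> N r \<inter> K \<subseteq> insert s R"
  shows "K - {s} \<subseteq> R"
proof -
  have "(K - {s}) \<inter> R = K - {s}"
    using assms by (intro critical_connected[of k K _ s]) auto
  then show ?thesis by blast
qed

section \<open>Maximum independent sets\<close>

definition max_independent :: "'a set \<Rightarrow> bool" where
  "max_independent S \<longleftrightarrow> S \<subseteq> V \<and> (\<forall>x\<in>S. N x \<inter> S = {}) \<and>
     (\<forall>T. T \<subseteq> V \<longrightarrow> (\<forall>x\<in>T. N x \<inter> T = {}) \<longrightarrow> card T \<le> card S)"

lemma max_independent_neighbour: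
  assumes S: "max_independent S" and x: "x \<in> V - S"
  shows "\<exists>s\<in>S. s \<in> N x"
proof (rule ccontr)
  assume no: "\<not> (\<exists>s\<in>S. s \<in> N x)"
  have "finite S" using S finite_V finite_subset unfolding max_independent_def by blast
  have "card (insert x S) \<le> card S"
  proof -
    have "insert x S \<subseteq> V" using S x unfolding max_independent_def by blast
    moreover have "\<forall>y\<in>insert x S. N y \<inter> insert x S = {}"
    proof
      fix y assume y: "y \<in> insert x S"
      have "N x \<inter> insert x S = {}" using no N_irrefl[of x] by blast
      moreover have "x \<notin> N y" if "y \<in> S" using no that N_sym[of x y] by blast
      moreover have "N y \<inter> S = {}" if "y \<in> S" using S that by (simp add: max_independent_def)
      ultimately show "N y \<inter> insert x S = {}" using y by blast
    qed
    ultimately show ?thesis using S unfolding max_independent_def by blast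
  qed
  then show False using x \<open>finite S\<close> by simp
qed

end

section \<open>Critical sets outside a maximum independent set, and exchanges\<close>

locale brooks_graph = neighbourhood_graph +
  fixes d :: nat
  assumes d3: "3 \<le> d"
    and degree_le: "card (N x) \<le> d"
    and no_clique: "\<lbrakk>Q \<subseteq> V; \<And>x y. x \<in> Q \<Longrightarrow> y \<in> Q \<Longrightarrow> x \<noteq> y \<Longrightarrow> y \<in> N x\<rbrakk> \<Longrightarrow> card Q \<noteq> Suc d"
begin

definition crit :: "'a set \<Rightarrow> 'a set set" where
  "crit S = {K. K \<subseteq> V - S \<and> critical (d - 1) K}"

definition optimal :: "'a set \<Rightarrow> bool" where
  "optimal S \<longleftrightarrow> max_independent S \<and>
     (\<forall>T. max_independent T \<longrightarrow> card (crit S) \<le> card (crit T))"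

lemma finite_crit: "finite (crit S)"
  using finite_V by (auto simp: crit_def intro: finite_subset[of _ "Pow V"])

text \<open>Criticality puts at least \<open>d - 1\<close> neighbours of \<open>x\<close> into
  \<open>K\<close>, and \<open>s\<close> is a further one outside \<open>K\<close>; the degree bound
  \<open>d\<close> makes both counts exact.\<close>

lemma crit_neighbours:
  assumes S: "max_independent S" and K: "K \<in> crit S" and x: "x \<in> K" and s: "s \<in> S" "s \<in> N x"
  shows "N x = insert s (N x \<inter> K)" "card (N x \<inter> K) = d - 1"
proof -
  have "s \<notin> K" using K s by (auto simp: crit_def)
  then have c: "card (insert s (N x \<inter> K)) = Suc (card (N x \<inter> K))"
    using finite_N by simp
  have "d - 1 \<le> card (N x \<inter> K)"
    using critical_degree K x by (auto simp: crit_def)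
  moreover have sub: "insert s (N x \<inter> K) \<subseteq> N x" using s by blast
  moreover have "card (insert s (N x \<inter> K)) \<le> card (N x)"
    by (rule card_mono[OF finite_N sub])
  ultimately show "card (N x \<inter> K) = d - 1"
    using c degree_le[of x] by linarith
  then have "card (N x) \<le> card (insert s (N x \<inter> K))"
    using c degree_le[of x] d3 by linarith
  then show "N x = insert s (N x \<inter> K)"
    using card_seteq[OF finite_N sub] by simp
qed

text \<open>No edge joins \<open>K\<close> to the rest of \<open>V - S\<close>, as the only
  neighbour of \<open>x\<close> outside \<open>K\<close> lies in \<open>S\<close>.\<close>

lemma crit_closed:
  assumes "max_independent S" "K \<in> crit S" "x \<in> K"
  shows "N x \<subseteq> S \<union> K"
proof -
  have "x \<in> V - S" using assms by (auto simp: crit_def)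
  then obtain s where s: "s \<in> S" "s \<in> N x"
    using max_independent_neighbour[OF assms(1)] by blast
  have "N x \<subseteq> insert s K" using crit_neighbours(1)[OF assms s] by blast
  then show ?thesis using s by blast
qed

lemma crit_degree:
  assumes "max_independent S" "K \<in> crit S" "x \<in> K"
  shows "card (N x \<inter> K) = d - 1"
proof -
  have "x \<in> V - S" using assms by (auto simp: crit_def)
  then show ?thesis
    using max_independent_neighbour[OF assms(1)] crit_neighbours(2)[OF assms] by blast
qed

text \<open>Connectedness of \<open>K\<close>, phrased for a set \<open>A\<close> that may reach
  outside \<open>K\<close>.\<close>

lemma crit_subset_of_closed:
  assumes "K \<in> crit S" "A \<inter> K \<noteq> {}" "\<And>a. a \<in> A \<inter> K \<Longrightarrow> N a \<inter> K \<subseteq> A"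
  shows "K \<subseteq> A"
proof -
  have "A \<inter> K = K"
    using assms by (intro critical_connected0[of "d - 1"]) (auto simp: crit_def)
  then show ?thesis by blast
qed

text \<open>Both sets are connected and closed under adjacency within \<open>V - S\<close>, so a
  common vertex forces each to contain the other.\<close>

lemma crit_eq:
  assumes S: "max_independent S" and K: "K \<in> crit S" "L \<in> crit S" "x \<in> K" "x \<in> L"
  shows "K = L"
proof -
  have "K \<subseteq> L" if "K \<in> crit S" "L \<in> crit S" "x \<in> K" "x \<in> L" for K L
  proof (rule crit_subset_of_closed[OF that(1)])
    show "N a \<inter> K \<subseteq> L" if "a \<in> L \<inter> K" for a
      using crit_closed[OF S \<open>L \<in> crit S\<close>, of a] \<open>K \<in> crit S\<close> that by (auto simp: crit_def)
  qed (use that in blast)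
  then show ?thesis using K by blast
qed

text \<open>The exchange destroys \<open>K\<close> and every new critical set contains
  \<open>s\<close>. Minimality demands at least one new set, disjointness allows at most one, so the
  number of critical sets stays minimal.\<close>

lemma optimal_swap:
  assumes S: "optimal S" and K: "K \<in> crit S" and v: "v \<in> K" and s: "s \<in> S" "s \<in> N v"
  defines "S' \<equiv> insert v (S - {s})"
  shows "optimal S'" "\<exists>L\<in>crit S'. s \<in> L"
proof -
  have mS: "max_independent S" using S by (simp add: optimal_def)
  have vV: "v \<in> V" "v \<notin> S" using K v by (auto simp: crit_def)
  have finS: "finite S" using mS finite_V finite_subset unfolding max_independent_def by blast
  \<comment> \<open>By the exact count of neighbours, \<open>s\<close> is the only neighbour of
    \<open>v\<close> in \<open>S\<close>.\<close>
  have "N v \<inter> (S - {s}) = {}"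
    using crit_neighbours(1)[OF mS K v s] K by (auto simp: crit_def)
  then have ind: "\<forall>x\<in>S'. N x \<inter> S' = {}"
  proof (intro ballI)
    fix x assume x: "x \<in> S'"
    have "N v \<inter> S' = {}" using \<open>N v \<inter> (S - {s}) = {}\<close> N_irrefl[of v] by (auto simp: S'_def)
    moreover have "v \<notin> N x" if "x \<in> S - {s}"
      using that \<open>N v \<inter> (S - {s}) = {}\<close> N_sym[of v x] by blast
    moreover have "N x \<inter> S = {}" if "x \<in> S" using mS that by (simp add: max_independent_def)
    ultimately show "N x \<inter> S' = {}" using x by (auto simp: S'_def)
  qed
  have "card S' = card S" using finS vV s card_Suc_Diff1[OF finS s(1)] by (simp add: S'_def)
  then have mS': "max_independent S'"
    using mS ind vV unfolding max_independent_def S'_def by auto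
  define C where "C = {L \<in> crit S'. s \<in> L}"
  \<comment> \<open>A critical set avoiding both \<open>v\<close> and \<open>s\<close> also avoids
    \<open>S\<close>, so it was there before; it is not \<open>K\<close>, which contains
    \<open>v\<close>.\<close>
  have C_old: "crit S' - C \<subseteq> crit S - {K}"
    using v by (auto simp: C_def crit_def S'_def)
  have less: "card (crit S' - C) < card (crit S)"
    using card_mono[OF _ C_old] finite_crit[of S] card_Suc_Diff1[OF finite_crit K] by simp
  have ge: "card (crit S) \<le> card (crit S')" using S mS' unfolding optimal_def by blast
  have split: "card (crit S') = card (crit S' - C) + card C"
    using card_Diff_subset[of C "crit S'"] finite_crit[of S'] card_mono[of "crit S'" C]
      finite_subset[of C "crit S'"] by (auto simp: C_def)
  then have "C \<noteq> {}" using less ge by auto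
  then show "\<exists>L\<in>crit S'. s \<in> L" by (auto simp: C_def)
  then obtain L where L: "L \<in> crit S'" "s \<in> L" by blast
  then have "C \<subseteq> {L}" using crit_eq[OF mS'] by (auto simp: C_def)
  then have "card C \<le> 1" using card_mono[of "{L}" C] by simp
  then have "card (crit S') \<le> card (crit S)" using split less by linarith
  then show "optimal S'" using S mS' unfolding optimal_def by (meson order_trans)
qed

text \<open>Exchanging \<open>s\<close> with any one of several neighbours \<open>v\<close> in
  \<open>K\<close> turns \<open>K\<close> into \<open>K - {v} \<union> {s}\<close>. Comparing
  degrees before and after shows that \<open>s\<close> sees \<open>v\<close> and all neighbours of
  \<open>v\<close> in \<open>K\<close>; doing this for every \<open>v\<close> yields the forbidden
  clique.\<close>

lemma crit_neighbours_le_1: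
  assumes S: "optimal S" and K: "K \<in> crit S" and s: "s \<in> S"
  shows "card (N s \<inter> K) \<le> 1"
proof (rule ccontr)
  assume *: "\<not> card (N s \<inter> K) \<le> 1"
  have mS: "max_independent S" using S by (simp add: optimal_def)
  have sK: "s \<notin> K" and critK: "critical (d - 1) K" using K s by (auto simp: crit_def)
  have nbr: "N s = insert v (N v \<inter> K)" if v: "v \<in> N s \<inter> K" for v
  proof -
    have sv: "s \<in> N v" using v N_sym by blast
    define S' where "S' = insert v (S - {s})"
    obtain L where optS': "optimal S'" and L: "L \<in> crit S'" "s \<in> L"
      using optimal_swap[OF S K _ s sv] v unfolding S'_def by blast
    have mS': "max_independent S'" using optS' by (simp add: optimal_def)
    have vL: "v \<notin> L" and LS: "L \<inter> S \<subseteq> {s}" and critL: "critical (d - 1) L"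
      using L by (auto simp: crit_def S'_def)
    have Kclosed: "N x \<subseteq> S \<union> K" if "x \<in> K" for x using crit_closed[OF mS K that] .
    \<comment> \<open>The second neighbour \<open>u\<close> stays outside \<open>S'\<close>, so it
      lies in \<open>L\<close> with \<open>s\<close>; this is where \<open>L\<close> and
      \<open>K\<close> meet.\<close>
    obtain u where u: "u \<in> N s \<inter> K" "u \<noteq> v"
      using * card_mono[of "{v}" "N s \<inter> K"] by auto
    have "u \<in> L" using crit_closed[OF mS' L] u K by (auto simp: crit_def S'_def)
    have "u \<noteq> s" using u sK by blast
    \<comment> \<open>Neither is \<open>s\<close> a cut vertex of \<open>L\<close> nor
      \<open>v\<close> one of \<open>K\<close>, so the overlap at \<open>u\<close> spreads in both
      directions and \<open>L - {s} = K - {v}\<close>.\<close>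
    have L_sub: "L - {s} \<subseteq> K - {v}"
      using critical_minus_subset[OF critL L(2), of "K - {v}"] \<open>u \<in> L\<close> u \<open>u \<noteq> s\<close> Kclosed vL LS
      by blast
    have K_sub: "K - {v} \<subseteq> L"
      using critical_minus_subset[OF critK, of v L] v \<open>u \<in> L\<close> u
        crit_closed[OF mS' L(1)] K by (auto simp: crit_def S'_def)
    \<comment> \<open>Passing from \<open>K\<close> to \<open>L\<close>, \<open>y\<close> loses its
      neighbour \<open>v\<close>; only \<open>s\<close> can make up for it, as both degrees are
      \<open>d - 1\<close>.\<close>
    have "s \<in> N y" if y: "y \<in> N v \<inter> K" for y
    proof (rule ccontr)
      assume "s \<notin> N y"
      have "y \<in> L" using y K_sub N_irrefl[of v] by blast
      have "N y \<inter> L \<subseteq> N y \<inter> K - {v}" using L_sub \<open>s \<notin> N y\<close> by blast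
      moreover have "v \<in> N y" using y N_sym by blast
      then have "N y \<inter> K - {v} \<subset> N y \<inter> K" using v by blast
      ultimately have "card (N y \<inter> L) < card (N y \<inter> K)"
        using finite_N[of y] by (meson finite_Int psubset_card_mono subset_psubset_trans)
      then show False
        using crit_degree[OF mS' L(1) \<open>y \<in> L\<close>] crit_degree[OF mS K] y by simp
    qed
    then have sub: "insert v (N v \<inter> K) \<subseteq> N s" using v N_sym by blast
    have "card (insert v (N v \<inter> K)) = d"
      using crit_degree[OF mS K] v N_irrefl[of v] finite_N[of v] d3 by simp
    then show ?thesis using card_seteq[OF finite_N sub] degree_le[of s] by simp
  qed
  have "N s \<inter> K \<noteq> {}" using * by (metis card.empty zero_le)
  then obtain v where v: "v \<in> N s \<inter> K" by blast
  \<comment> \<open>Applying \<open>nbr\<close> at every neighbour of \<open>s\<close> shows that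
    \<open>N s\<close> is closed under adjacency in \<open>K\<close>; connectedness then gives
    \<open>N s = K\<close>.\<close>
  have "N s \<subseteq> K" by (subst nbr[OF v]) (use v in blast)
  have "N x \<inter> K \<subseteq> N s" if "x \<in> N s" for x
  proof -
    have "x \<in> N s \<inter> K" using that \<open>N s \<subseteq> K\<close> by blast
    then show ?thesis by (subst nbr) auto
  qed
  then have "K \<subseteq> N s"
    using v by (intro crit_subset_of_closed[OF K]) auto
  then have "N s = K" using \<open>N s \<subseteq> K\<close> by blast
  have "card (N s) = Suc (card (N v \<inter> K))"
    by (subst nbr[OF v]) (simp add: finite_N N_irrefl)
  then have "card (insert s (N s)) = Suc d"
    using crit_degree[OF mS K, of v] v d3 by (simp add: finite_N N_irrefl)
  moreover have "card (insert s (N s)) \<noteq> Suc d"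
  proof (rule no_clique)
    show "insert s (N s) \<subseteq> V" using N_subset mS s unfolding max_independent_def by blast
    show "y \<in> N x" if xy: "x \<in> insert s (N s)" "y \<in> insert s (N s)" "x \<noteq> y" for x y
    proof (cases "x = s \<or> y = s")
      case True
      then show ?thesis using xy N_sym[of x s] by blast
    next
      case False
      then have "x \<in> N s \<inter> K" using xy \<open>N s \<subseteq> K\<close> by blast
      then have "y \<in> insert x (N x \<inter> K)" using False xy(2) nbr[of x] by simp
      then show ?thesis using xy(3) by simp
    qed
  qed
  ultimately show False by simp
qed

section \<open>The walk of repeated exchanges\<close>

text \<open>
  The state of the walk: \<open>K\<close> is the current critical set, entered at \<open>e\<close>, and \<open>F\<close> holds the sets
  left behind, that is, the earlier critical sets without their exit vertices. The second
  alternative of the last condition describes the exit vertices, which now lie in \<open>S\<close>.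
\<close>

definition walk_state :: "'a set \<Rightarrow> 'a set \<Rightarrow> 'a \<Rightarrow> 'a set set \<Rightarrow> bool" where
  "walk_state S K e F \<longleftrightarrow> optimal S \<and> K \<in> crit S \<and> e \<in> K \<and>
     (\<forall>R\<in>F. R \<subseteq> V - S - K \<and> (\<forall>r\<in>R. N r \<subseteq> S \<union> R)) \<and>
     (\<forall>u\<in>S. \<forall>R\<in>F. card (N u \<inter> R) \<le> 1 \<or> N u \<subseteq> insert e (\<Union>F))"

text \<open>The walk leaves \<open>K\<close> through a neighbour \<open>w\<close> of the entry
  vertex \<open>e\<close>, which is exchanged with its neighbour \<open>t\<close> in
  \<open>S\<close>; \<open>t\<close> is the next entry vertex. The remainder \<open>K - {w}\<close>
  contains \<open>e\<close>, so the region left behind grows.\<close>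

lemma walk_step:
  assumes "walk_state S K e F"
  shows "\<exists>S' K' e' F'. walk_state S' K' e' F' \<and> card (\<Union>F) < card (\<Union>F')"
proof -
  have S: "optimal S" and K: "K \<in> crit S" and e: "e \<in> K"
    and FR: "\<And>R. R \<in> F \<Longrightarrow> R \<subseteq> V - S - K" and Fcl: "\<And>R r. R \<in> F \<Longrightarrow> r \<in> R \<Longrightarrow> N r \<subseteq> S \<union> R"
    and Fnb: "\<And>u R. u \<in> S \<Longrightarrow> R \<in> F \<Longrightarrow> card (N u \<inter> R) \<le> 1 \<or> N u \<subseteq> insert e (\<Union>F)"
    using assms unfolding walk_state_def by blast+
  have mS: "max_independent S" using S by (simp add: optimal_def)
  have KVS: "K \<subseteq> V - S" using K by (simp add: crit_def)
  have "2 \<le> card (N e \<inter> K)" using crit_degree[OF mS K e] d3 by simp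
  then have "N e \<inter> K \<noteq> {}" by (metis card.empty not_numeral_le_zero)
  then obtain w where w: "w \<in> N e" "w \<in> K" by blast
  then have "w \<noteq> e" using N_irrefl by blast
  obtain t where t: "t \<in> S" "t \<in> N w" using max_independent_neighbour[OF mS] w KVS by blast
  have wt: "w \<in> N t" using t N_sym by blast
  have Nw: "N w \<subseteq> insert t K" using crit_neighbours(1)[OF mS K w(2) t] by blast
  have one_new: "card (N u \<inter> (K - {w})) \<le> 1" if "u \<in> S" for u
    using crit_neighbours_le_1[OF S K that] card_mono[of "N u \<inter> K" "N u \<inter> (K - {w})"] finite_N[of u]
    by (meson Diff_subset Int_mono finite_Int order_refl order_trans)
  define S' where "S' = insert w (S - {t})"
  define F' where "F' = insert (K - {w}) F"
  obtain L where optS': "optimal S'" and L: "L \<in> crit S'" "t \<in> L"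
    using optimal_swap[OF S K w(2) t] unfolding S'_def by blast
  have mS': "max_independent S'" using optS' by (simp add: optimal_def)
  have critL: "critical (d - 1) L" and wL: "w \<notin> L" and LS: "L \<inter> S \<subseteq> {t}"
    using L by (auto simp: crit_def S'_def)
  have wF: "w \<notin> \<Union>F" using FR w by blast
  \<comment> \<open>For an old \<open>R\<close>, the exceptional alternative of the invariant fails
    at \<open>t\<close>: its neighbour \<open>w\<close> is neither \<open>e\<close> nor in
    \<open>\<Union>F\<close>.\<close>
  have one: "card (N t \<inter> R) \<le> 1" if "R \<in> F'" for R
    using that one_new[OF t(1)] Fnb[OF t(1), of R] wt wF \<open>w \<noteq> e\<close> unfolding F'_def by blast
  have sub': "R \<subseteq> V - S - {w}" if "R \<in> F'" for R
    using that FR w KVS unfolding F'_def by blast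
  have cl: "N r \<subseteq> insert w (S \<union> R)" if "R \<in> F'" "r \<in> R" for R r
    using that Fcl[of R r] crit_closed[OF mS K, of r] unfolding F'_def by auto
  \<comment> \<open>If \<open>L\<close> met \<open>R\<close>, then \<open>L - {t}\<close> would lie
    inside \<open>R\<close>, since \<open>t\<close> is not a cut vertex of \<open>L\<close>. So
    \<open>t\<close> would have at most one neighbour in \<open>L\<close>, but it has
    \<open>d - 1\<close>, which is at least 2.\<close>
  have disj: "R \<inter> L = {}" if R: "R \<in> F'" for R
  proof (rule ccontr)
    assume "R \<inter> L \<noteq> {}"
    then have "(L - {t}) \<inter> R \<noteq> {}" using sub'[OF R] t by blast
    moreover have "N r \<inter> L \<subseteq> insert t R" if "r \<in> R" for r
      using cl[OF R that] wL LS by blast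
    ultimately have "L - {t} \<subseteq> R" by (rule critical_minus_subset[OF critL L(2)])
    then have "N t \<inter> L \<subseteq> N t \<inter> R" using N_irrefl by blast
    then have "card (N t \<inter> L) \<le> 1"
      using one[OF R] card_mono[of "N t \<inter> R" "N t \<inter> L"] finite_N[of t] by simp
    then show False using crit_degree[OF mS' L] d3 by simp
  qed
  have "walk_state S' L t F'"
    unfolding walk_state_def
  proof (intro conjI ballI)
    fix R assume R: "R \<in> F'"
    show "R \<subseteq> V - S' - L" using sub'[OF R] disj[OF R] by (auto simp: S'_def)
    show "N r \<subseteq> S' \<union> R" if r: "r \<in> R" for r
    proof -
      have "t \<notin> N r"
        using crit_closed[OF mS' L] N_sym[of t r] sub'[OF R] disj[OF R] r
        by (auto simp: S'_def)
      then show ?thesis using cl[OF R r] by (auto simp: S'_def)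
    qed
    fix u assume u: "u \<in> S'"
    show "card (N u \<inter> R) \<le> 1 \<or> N u \<subseteq> insert t (\<Union>F')"
    \<comment> \<open>The fresh exit vertex \<open>w\<close> has all its neighbours in
      \<open>insert t (K - {w})\<close>, which is the exceptional alternative. For older exit
      vertices it persists because \<open>e\<close> has joined \<open>\<Union>F'\<close>.\<close>
    proof (cases "u = w")
      case True
      then show ?thesis using Nw N_irrefl[of w] by (auto simp: F'_def)
    next
      case False
      then have "u \<in> S" using u by (simp add: S'_def)
      have "insert e (\<Union>F) \<subseteq> \<Union>F'" using e \<open>w \<noteq> e\<close> by (auto simp: F'_def)
      then have sub: "insert e (\<Union>F) \<subseteq> insert t (\<Union>F')" by (rule subset_insertI2)
      show ?thesis
      proof (cases "R = K - {w}")
        case True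
        then show ?thesis using one_new[OF \<open>u \<in> S\<close>] by simp
      next
        case False
        then have "R \<in> F" using R by (simp add: F'_def)
        then show ?thesis using Fnb[OF \<open>u \<in> S\<close>] order_trans[OF _ sub] by blast
      qed
    qed
  qed (use optS' L in auto)
  moreover have "card (\<Union>F) < card (\<Union>F')"
  proof (rule psubset_card_mono)
    show "finite (\<Union>F')" using sub' finite_V by (meson Diff_subset Sup_least finite_subset order_trans)
    show "\<Union>F \<subset> \<Union>F'" using FR e \<open>w \<noteq> e\<close> unfolding F'_def by blast
  qed
  ultimately show ?thesis by blast
qed

text \<open>Each step enlarges \<open>\<Union>F\<close>, which stays inside \<open>V\<close>, so
  \<open>card V - card (\<Union>F)\<close> would decrease strictly forever.\<close>

lemma no_walk_state: "\<not> walk_state S K e F"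
proof (induction "card V - card (\<Union>F)" arbitrary: S K e F rule: less_induct)
  case less
  show ?case
  proof
    assume "walk_state S K e F"
    then obtain S' K' e' F' where F': "walk_state S' K' e' F'" "card (\<Union>F) < card (\<Union>F')"
      using walk_step by blast
    have "\<Union>F' \<subseteq> V" using F'(1) unfolding walk_state_def by blast
    then have "card (\<Union>F') \<le> card V" using card_mono[OF finite_V] by blast
    then show False using less F' by (meson diff_less_mono2 less_le_trans)
  qed
qed

lemma optimal_colorable:
  assumes S: "optimal S"
  shows "colorable (d - 1) (V - S)"
proof (rule ccontr)
  assume "\<not> colorable (d - 1) (V - S)"
  then obtain K where K: "K \<in> crit S" using ex_critical_subset[of "V - S"] by (auto simp: crit_def)
  then have "K \<noteq> {}" using colorable_empty by (auto simp: crit_def critical_def)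
  then obtain e where "e \<in> K" by blast
  then have "walk_state S K e {}" using S K by (simp add: walk_state_def)
  then show False using no_walk_state by blast
qed

lemma ex_max_independent_colorable:
  assumes "max_independent S0"
  shows "\<exists>S. max_independent S \<and> colorable (d - 1) (V - S)"
proof -
  obtain S where "optimal S"
    using ex_has_least_nat[of max_independent S0 "\<lambda>S. card (crit S)"] assms
    unfolding optimal_def by blast
  then show ?thesis using optimal_colorable unfolding optimal_def by blast
qed

end

section \<open>Transfer to digraphs and the final colouring\<close>

text \<open>Without parallel arcs, \<open>head G\<close> is injective on the arcs leaving
  \<open>x\<close>.\<close>

lemma out_degree_eq_card_neighbours:
  assumes "graph G"
  shows "out_degree G x = card {y. x \<rightarrow>\<^bsub>G\<^esub> y}"
proof -
  interpret graph G by fact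
  have "{y. x \<rightarrow>\<^bsub>G\<^esub> y} = head G ` out_arcs G x"
    by (auto simp: arcs_ends_def arc_to_ends_def out_arcs_def image_iff)
  moreover have "inj_on (head G) (out_arcs G x)"
    by (rule inj_onI) (auto simp: out_arcs_def arc_to_ends_def intro!: no_multi_arcs)
  ultimately show ?thesis by (simp add: out_degree_def card_image)
qed

text \<open>Turns a clique of \<open>d + 1\<close> vertices into the excluded subgraph, which gives
  \<open>no_clique\<close>.\<close>

lemma complete_digraph_induce_subgraph:
  assumes "graph G" "Q \<subseteq> verts G" "\<And>x y. x \<in> Q \<Longrightarrow> y \<in> Q \<Longrightarrow> x \<noteq> y \<Longrightarrow> x \<rightarrow>\<^bsub>G\<^esub> y"
  shows "subgraph (G \<restriction> Q) G" "complete_digraph (card Q) (G \<restriction> Q)"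
proof -
  interpret graph G by fact
  show sub: "subgraph (G \<restriction> Q) G" by (rule subgraph_induce_subgraphI) fact
  have "graph (G \<restriction> Q)"
    using induced_graph_imp_graph[OF induced_induce[OF assms(2)]]
      digraphI_induced[OF induced_induce[OF assms(2)]]
    by (simp add: graph_def digraph_def sym_digraph_def pseudo_graph_def)
  moreover have "arcs_ends (G \<restriction> Q) = {(u,v). (u,v) \<in> Q \<times> Q \<and> u \<noteq> v}"
  proof -
    have "arcs_ends (G \<restriction> Q) = arcs_ends G \<inter> Q \<times> Q"
      by (auto simp: arcs_ends_def arc_to_ends_def)
    then show ?thesis using assms(3) adj_not_same by blast
  qed
  ultimately show "complete_digraph (card Q) (G \<restriction> Q)" by (simp add: complete_digraph_def)
qed

theorem theorem1:
  fixes G :: "('a, 'b) pre_digraph" and d :: nat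
  assumes "d \<ge> 3"
    and "graph G"
    and "max_degree G = d"
    and "\<not> (\<exists>H. subgraph H G \<and> complete_digraph (d + 1) H)"
  shows "(\<exists>C. coloring G d C \<and> (\<exists>i<d. card (C i) = independence_number G))
    \<and> chromatic_number G \<le> d"
proof -
  interpret G: graph G by fact
  define N where "N x = {y. x \<rightarrow>\<^bsub>G\<^esub> y}" for x
  have deg: "card (N x) \<le> d" for x
  proof (cases "x \<in> verts G")
    case True
    then have "out_degree G x \<le> max_degree G"
      unfolding max_degree_def by (intro Max_ge) auto
    then show ?thesis using out_degree_eq_card_neighbours[OF assms(2)] assms(3) by (simp add: N_def)
  next
    case False
    then have "N x = {}" using G.adj_in_verts by (auto simp: N_def)
    then show ?thesis by simp
  qed
  interpret brooks_graph "verts G" N d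
  proof
    show "finite (verts G)" by simp
    show "N x \<subseteq> verts G" for x using G.adj_in_verts by (auto simp: N_def)
    show "x \<notin> N x" for x using G.adj_not_same by (auto simp: N_def)
    show "x \<in> N y" if "y \<in> N x" for x y using that G.sym_arcs by (auto simp: N_def symmetric_def dest: symD)
    show "card Q \<noteq> Suc d" if "Q \<subseteq> verts G" "\<And>x y. x \<in> Q \<Longrightarrow> y \<in> Q \<Longrightarrow> x \<noteq> y \<Longrightarrow> y \<in> N x" for Q
    proof
      assume "card Q = Suc d"
      then show False
        using complete_digraph_induce_subgraph[OF assms(2) that(1)] that(2) assms(4)
        by (auto simp: N_def)
    qed
  qed (use assms(1) deg in auto)
  have ind: "independent_set G T \<longleftrightarrow> T \<subseteq> verts G \<and> (\<forall>x\<in>T. N x \<inter> T = {})" for T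
    by (auto simp: independent_set_def N_def)
  have fin: "finite (card ` {S. independent_set G S})"
    by (rule finite_imageI, rule finite_subset[of _ "Pow (verts G)"]) (auto simp: ind)
  have card_le: "card T \<le> independence_number G" if "independent_set G T" for T
    unfolding independence_number_def using fin that by (intro Max_ge) auto
  obtain S0 where S0: "independent_set G S0" "card S0 = independence_number G"
    using independence_number_attained[OF assms(2)] by blast
  then have "max_independent S0" using card_le by (auto simp: max_independent_def ind)
  then obtain S where S: "max_independent S" and col: "colorable (d - 1) (verts G - S)"
    using ex_max_independent_colorable by blast
  have indS: "independent_set G S" using S by (simp add: max_independent_def ind)
  have "card S0 \<le> card S" using S S0(1) by (simp add: max_independent_def ind)
  then have cardS: "card S = independence_number G" using card_le[OF indS] S0(2) by simp
  obtain f :: "'a \<Rightarrow> nat" where f: "\<And>x. x \<in> verts G - S \<Longrightarrow> f x < d - 1"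
    "\<And>x y. x \<in> verts G - S \<Longrightarrow> y \<in> verts G - S \<Longrightarrow> y \<in> N x \<Longrightarrow> f x \<noteq> f y"
    using col unfolding colorable_def by (metis image_subset_iff lessThan_iff)
  \<comment> \<open>The colours below \<open>d - 1\<close> are used up by \<open>f\<close>; the last
    one, \<open>d - 1\<close>, is reserved for \<open>S\<close>.\<close>
  define C where "C i = (if i = d - 1 then S else {x \<in> verts G - S. f x = i})" for i
  have "coloring G d C"
    unfolding coloring_def
  proof (intro conjI allI impI)
    show "(\<Union>i<d. C i) = verts G"
    proof (intro equalityI subsetI)
      fix x assume x: "x \<in> verts G"
      then have "x \<in> C (if x \<in> S then d - 1 else f x)" using f(1)[of x] by (auto simp: C_def)
      moreover have "(if x \<in> S then d - 1 else f x) < d" using f(1)[of x] x assms(1) by auto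
      ultimately show "x \<in> (\<Union>i<d. C i)" by blast
    qed (use indS in \<open>auto simp: C_def ind split: if_splits\<close>)
    show "disjoint_family_on C {..<d}" by (auto simp: disjoint_family_on_def C_def)
    show "independent_set G (C i)" for i
    proof (cases "i = d - 1")
      case False
      have "N x \<inter> C i = {}" if "x \<in> C i" for x
        using that f(2)[of x] False unfolding C_def by fastforce
      moreover have "C i \<subseteq> verts G" using False by (auto simp: C_def)
      ultimately show ?thesis by (simp add: ind)
    qed (use indS in \<open>simp add: C_def\<close>)
  qed
  moreover have "d - 1 < d" "card (C (d - 1)) = independence_number G"
    using assms(1) cardS by (simp_all add: C_def)
  moreover have "chromatic_number G \<le> d"
    unfolding chromatic_number_def using \<open>coloring G d C\<close> by (intro Least_le) blast
  ultimately show ?thesis by blast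
qed

end
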